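(* Let $d\ge2$ and $1\le p\le\infty$. Then the Wasserstein space $W_p(\mathbf{R}^d)$ has positive upper (Alexandrov) curvature, i.e. $\kappa(\mu)>0$ for every $\mu\in W_p(\mathbf{R}^d)$.
   Context: $W_p(\mathbf{R}^d)$ denotes the metric space $(\mathcal{P}_p(\mathbf{R}^d),W_p)$. For $1\le p<\infty$, $\mathcal{P}_p(\mathbf{R}^d)$ is the set of Borel probability measures on $\mathbf{R}^d$ with finite $p$-th moment, and $W_p^p(\mu,\nu)=\inf_\gamma\int|x-y|^p\,d\gamma(x,y)$, the infimum being over all transport plans $\gamma$ between $\mu$ and $\nu$ (Borel probability measures on $\mathbf{R}^d\times\mathbf{R}^d$ with marginals $\mu$ and $\nu$), with $|\cdot|$ the Euclidean norm. For $p=\infty$, $\mathcal{P}_\infty(\mathbf{R}^d)$ is the set of Borel probability measures with bounded support and $W_\infty(\mu,\nu)=\inf_\gamma\,\gamma\text{-}\operatorname{ess\,sup}|x-y|$ over the same transport plans. Upper Alexandrov curvature: for a locally geodesic metric space $X$ and $x\in X$, $\kappa(x):=\inf\kappa'$, where the infimum is over all pairs $(U,\kappa')$ with $U$ a geodesic neighborhood of $x$ of Alexandrov curvature $\le\kappa'$ (curvature bounded above by $\kappa'\in\mathbf{R}$ in the sense of Alexandrov, via triangle comparison with the model plane of constant curvature $\kappa'$), with the convention $\inf\emptyset=+\infty$. If $X$ is a Riemannian manifold, $\kappa(x)$ is the maximum of the sectional curvatures at $x$. $X$ has positive upper curvature if $\kappa(x)>0$ for all $x\in X$. *)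

theory Defs
  imports "HOL-Probability.Probability"
begin

section \<open>Upper Alexandrov curvature\<close>

text \<open>
  A metric space is given by a carrier and a distance function, and a subset of it carries the
  restriction of the same distance function.  Balls and neighbourhoods are written out on the
  carrier, so that no definition below depends on the metric axioms.  Geodesics are parametrised
  by arc length on \<open>[0, d x y]\<close>.
\<close>

definition geodesic :: "'a set \<Rightarrow> ('a \<Rightarrow> 'a \<Rightarrow> real) \<Rightarrow> 'a \<Rightarrow> 'a \<Rightarrow> (real \<Rightarrow> 'a) \<Rightarrow> bool"
  where "geodesic X d x y c \<longleftrightarrow>
    c 0 = x \<and> c (d x y) = y \<and> (\<forall>s\<in>{0..d x y}. c s \<in> X) \<and>
    (\<forall>s\<in>{0..d x y}. \<forall>t\<in>{0..d x y}. d (c s) (c t) = \<bar>s - t\<bar>)"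

definition geodesic_space :: "'a set \<Rightarrow> ('a \<Rightarrow> 'a \<Rightarrow> real) \<Rightarrow> bool"
  where "geodesic_space X d \<longleftrightarrow> (\<forall>x\<in>X. \<forall>y\<in>X. \<exists>c. geodesic X d x y c)"

definition geodesic_triangle ::
    "'a set \<Rightarrow> ('a \<Rightarrow> 'a \<Rightarrow> real) \<Rightarrow> 'a \<Rightarrow> 'a \<Rightarrow> 'a \<Rightarrow>
      (real \<Rightarrow> 'a) \<Rightarrow> (real \<Rightarrow> 'a) \<Rightarrow> (real \<Rightarrow> 'a) \<Rightarrow> bool"
  where "geodesic_triangle X d x y z a b c \<longleftrightarrow>
    x \<in> X \<and> y \<in> X \<and> z \<in> X \<and>
    geodesic X d x y a \<and> geodesic X d y z b \<and> geodesic X d z x c"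

text \<open>
  The model plane of constant curvature \<open>\<kappa>\<close>, inside three-dimensional space: for \<open>\<kappa> > 0\<close> the
  unit sphere with angular distance scaled by \<open>1/sqrt \<kappa>\<close>; for \<open>\<kappa> = 0\<close> a Euclidean plane; for
  \<open>\<kappa> < 0\<close> the upper sheet of the hyperboloid with hyperbolic distance scaled by \<open>1/sqrt (-\<kappa>)\<close>.
\<close>

definition lorentz :: "real^3 \<Rightarrow> real^3 \<Rightarrow> real"
  where "lorentz x y = x$1 * y$1 + x$2 * y$2 - x$3 * y$3"

definition model_plane :: "real \<Rightarrow> (real^3) set"
  where "model_plane \<kappa> =
    (if \<kappa> > 0 then {x. norm x = 1}
     else if \<kappa> = 0 then {x. x$3 = 0}
     else {x. lorentz x x = -1 \<and> x$3 > 0})"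

definition model_dist :: "real \<Rightarrow> real^3 \<Rightarrow> real^3 \<Rightarrow> real"
  where "model_dist \<kappa> x y =
    (if \<kappa> > 0 then arccos (x \<bullet> y) / sqrt \<kappa>
     else if \<kappa> = 0 then dist x y
     else arcosh (- lorentz x y) / sqrt (- \<kappa>))"

text \<open>The diameter of the model plane.\<close>

definition model_diameter :: "real \<Rightarrow> ereal"
  where "model_diameter \<kappa> = (if \<kappa> > 0 then ereal (pi / sqrt \<kappa>) else \<infinity>)"

text \<open>
  The primed data form the comparison triangle.  Corresponding sides have equal length, hence a
  point at parameter \<open>s\<close> of a side and the point at parameter \<open>s\<close> of the corresponding primed side
  are comparison points of each other; \<open>S\<close> is the set of all such pairs.
\<close>

definition CAT_inequality ::
    "real \<Rightarrow> ('a \<Rightarrow> 'a \<Rightarrow> real) \<Rightarrow> 'a \<Rightarrow> 'a \<Rightarrow> 'a \<Rightarrow>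
      (real \<Rightarrow> 'a) \<Rightarrow> (real \<Rightarrow> 'a) \<Rightarrow> (real \<Rightarrow> 'a) \<Rightarrow> bool"
  where "CAT_inequality \<kappa> d x y z a b c \<longleftrightarrow>
    (\<forall>x' y' z' a' b' c'.
       geodesic_triangle (model_plane \<kappa>) (model_dist \<kappa>) x' y' z' a' b' c' \<and>
       model_dist \<kappa> x' y' = d x y \<and> model_dist \<kappa> y' z' = d y z \<and> model_dist \<kappa> z' x' = d z x \<longrightarrow>
       (let S = (\<lambda>s. (a s, a' s)) ` {0..d x y} \<union>
                (\<lambda>s. (b s, b' s)) ` {0..d y z} \<union>
                (\<lambda>s. (c s, c' s)) ` {0..d z x}
        in \<forall>(u, u')\<in>S. \<forall>(v, v')\<in>S. d u v \<le> model_dist \<kappa> u' v'))"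

definition CAT :: "real \<Rightarrow> 'a set \<Rightarrow> ('a \<Rightarrow> 'a \<Rightarrow> real) \<Rightarrow> bool"
  where "CAT \<kappa> X d \<longleftrightarrow>
    (\<forall>x\<in>X. \<forall>y\<in>X. ereal (d x y) < model_diameter \<kappa> \<longrightarrow> (\<exists>c. geodesic X d x y c)) \<and>
    (\<forall>x y z a b c.
       geodesic_triangle X d x y z a b c \<and>
       ereal (d x y + d y z + d z x) < 2 * model_diameter \<kappa> \<longrightarrow>
       CAT_inequality \<kappa> d x y z a b c)"

text \<open>Alexandrov curvature bounded above by \<open>\<kappa>\<close>: the space is locally a CAT space.\<close>

definition curvature_le :: "real \<Rightarrow> 'a set \<Rightarrow> ('a \<Rightarrow> 'a \<Rightarrow> real) \<Rightarrow> bool"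
  where "curvature_le \<kappa> X d \<longleftrightarrow> (\<forall>x\<in>X. \<exists>r>0. CAT \<kappa> {y\<in>X. d x y < r} d)"

definition geodesic_neighborhood :: "'a set \<Rightarrow> ('a \<Rightarrow> 'a \<Rightarrow> real) \<Rightarrow> 'a \<Rightarrow> 'a set \<Rightarrow> bool"
  where "geodesic_neighborhood X d x U \<longleftrightarrow>
    U \<subseteq> X \<and> (\<exists>r>0. {y\<in>X. d x y < r} \<subseteq> U) \<and> geodesic_space U d"

text \<open>In \<^typ>\<open>ereal\<close>, the infimum of the empty set is \<open>\<infinity>\<close>.\<close>

definition upper_curvature :: "'a set \<Rightarrow> ('a \<Rightarrow> 'a \<Rightarrow> real) \<Rightarrow> 'a \<Rightarrow> ereal"
  where "upper_curvature X d x =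
    Inf {ereal \<kappa> |\<kappa> U. geodesic_neighborhood X d x U \<and> curvature_le \<kappa> U d}"

definition positive_upper_curvature :: "'a set \<Rightarrow> ('a \<Rightarrow> 'a \<Rightarrow> real) \<Rightarrow> bool"
  where "positive_upper_curvature X d \<longleftrightarrow> (\<forall>x\<in>X. upper_curvature X d x > 0)"


section \<open>Wasserstein spaces\<close>

definition measure_support :: "'a::topological_space measure \<Rightarrow> 'a set"
  where "measure_support \<mu> = {x. \<forall>U. open U \<and> x \<in> U \<longrightarrow> emeasure \<mu> U > 0}"

definition borel_prob :: "'a::topological_space measure \<Rightarrow> bool"
  where "borel_prob \<mu> \<longleftrightarrow> prob_space \<mu> \<and> sets \<mu> = sets borel"

definition wasserstein_carrier :: "ennreal \<Rightarrow> 'a::euclidean_space measure set"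
  where "wasserstein_carrier p =
    (if p = \<infinity> then {\<mu>. borel_prob \<mu> \<and> bounded (measure_support \<mu>)}
     else {\<mu>. borel_prob \<mu> \<and> (\<integral>\<^sup>+x. ennreal (norm x powr enn2real p) \<partial>\<mu>) < \<infinity>})"

definition transport_plans ::
    "'a::euclidean_space measure \<Rightarrow> 'a measure \<Rightarrow> ('a \<times> 'a) measure set"
  where "transport_plans \<mu> \<nu> =
    {\<gamma>. borel_prob \<gamma> \<and> distr \<gamma> borel fst = \<mu> \<and> distr \<gamma> borel snd = \<nu>}"

text \<open>
  On \<^const>\<open>wasserstein_carrier\<close> the infima are finite, so the conversion to real numbers loses
  nothing there.
\<close>

definition wasserstein_dist ::
    "ennreal \<Rightarrow> 'a::euclidean_space measure \<Rightarrow> 'a measure \<Rightarrow> real"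
  where "wasserstein_dist p \<mu> \<nu> =
    (if p = \<infinity> then
       enn2real (INF \<gamma>\<in>transport_plans \<mu> \<nu>. esssup \<gamma> (\<lambda>(x, y). ennreal (norm (x - y))))
     else
       enn2real (INF \<gamma>\<in>transport_plans \<mu> \<nu>.
         \<integral>\<^sup>+(x, y). ennreal (norm (x - y) powr enn2real p) \<partial>\<gamma>) powr (1 / enn2real p))"

end

theory Submission
  imports Defs
begin

text \<open>
  No ball of a Wasserstein space over a space of dimension at least two satisfies a CAT
  inequality, so the upper curvature is \<open>\<infinity>\<close> everywhere.  Given \<open>\<mu>\<close>, round it to a fine
  lattice and pick a lattice point \<open>z\<close> of positive mass \<open>w\<close>.  Let \<open>\<sigma> u\<close> be the rounded measure
  in which the atom at \<open>z\<close> is replaced by two halves at \<open>z + u\<close> and \<open>z - u\<close>.  For short \<open>u\<close> and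
  \<open>v\<close> with \<open>u \<bullet> v \<ge> 0\<close>, it is optimal to move the halves to the nearest halves and to leave the rest alone,
  so the distance of \<open>\<sigma> u\<close> and \<open>\<sigma> v\<close> is \<open>norm (u - v)\<close> times a constant depending on \<open>w\<close>.  If
  \<open>a\<close> and \<open>b\<close> are orthogonal, the segments from \<open>a\<close> to \<open>b\<close> and from \<open>a\<close> to \<open>-b\<close> therefore give two
  geodesics from \<open>\<sigma> a\<close> to \<open>\<sigma> b = \<sigma> (- b)\<close> with distinct midpoints.  CAT spaces admit no such
  pairs at small scales.
\<close>

section \<open>Branching geodesics exclude upper curvature bounds\<close>

text \<open>The curves are a great circle, a straight line and a branch of a hyperbola, all
  parametrised by arc length. In the spherical case the bound on \<open>D\<close> keeps all angles
  within the range of \<open>arccos\<close>.\<close>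

lemma model_plane_geodesic_exists:
  assumes "ereal D < model_diameter \<kappa>"
  obtains \<gamma> where "\<And>s. \<gamma> s \<in> model_plane \<kappa>"
    and "\<And>s t. s \<in> {0..D} \<Longrightarrow> t \<in> {0..D} \<Longrightarrow> model_dist \<kappa> (\<gamma> s) (\<gamma> t) = \<bar>s - t\<bar>"
proof -
  consider "\<kappa> > 0" | "\<kappa> = 0" | "\<kappa> < 0" by linarith
  then show thesis
  proof cases
    case 1
    define k where "k = sqrt \<kappa>"
    have k: "k > 0" using 1 by (simp add: k_def)
    define \<gamma> where "\<gamma> s = (vector [cos (k * s), sin (k * s), 0] :: real^3)" for s
    have inner: "\<gamma> s \<bullet> \<gamma> t = cos (k * (s - t))" for s t
      by (simp add: \<gamma>_def inner_vec_def sum_3 vector_3 cos_diff algebra_simps)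
    have "\<gamma> s \<in> model_plane \<kappa>" for s
      using 1 inner[of s s] by (simp add: model_plane_def norm_eq_sqrt_inner)
    moreover have "model_dist \<kappa> (\<gamma> s) (\<gamma> t) = \<bar>s - t\<bar>" if "s \<in> {0..D}" "t \<in> {0..D}" for s t
    proof -
      have "D < pi / k" using assms 1 by (simp add: model_diameter_def k_def)
      then have "k * D < pi" using k by (simp add: field_simps)
      moreover have "k * \<bar>s - t\<bar> \<le> k * D"
        using that k by (intro mult_left_mono) auto
      moreover have "\<bar>k * (s - t)\<bar> = k * \<bar>s - t\<bar>" using k by (simp add: abs_mult)
      ultimately have "\<bar>k * (s - t)\<bar> \<le> pi" by linarith
      then have "arccos (\<gamma> s \<bullet> \<gamma> t) = \<bar>k * (s - t)\<bar>"
        unfolding inner by (rule arccos_cos_eq_abs)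
      then show ?thesis using 1 k by (simp add: model_dist_def abs_mult flip: k_def)
    qed
    ultimately show thesis by (rule that)
  next
    case 2
    define \<gamma> where "\<gamma> s = (vector [s, 0, 0] :: real^3)" for s
    show thesis
      by (rule that[of \<gamma>])
        (simp_all add: 2 \<gamma>_def model_plane_def model_dist_def dist_vec_def L2_set_def sum_3
          vector_3 dist_real_def)
  next
    case 3
    define k where "k = sqrt (- \<kappa>)"
    have k: "k > 0" using 3 by (simp add: k_def)
    define \<gamma> where "\<gamma> s = (vector [sinh (k * s), 0, cosh (k * s)] :: real^3)" for s
    have lor: "lorentz (\<gamma> s) (\<gamma> t) = - cosh \<bar>k * (s - t)\<bar>" for s t
      by (simp add: \<gamma>_def lorentz_def vector_3 cosh_diff algebra_simps)
    show thesis
    proof (rule that[of \<gamma>])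
      show "\<gamma> s \<in> model_plane \<kappa>" for s
        using 3 lor[of s s] by (simp add: model_plane_def) (simp add: \<gamma>_def vector_3)
      show "model_dist \<kappa> (\<gamma> s) (\<gamma> t) = \<bar>s - t\<bar>" for s t
        using 3 k lor[of s t]
        by (simp add: model_dist_def arcosh_cosh_real abs_mult flip: k_def del: cosh_real_abs)
    qed
  qed
qed

section \<open>Comparison in a degenerate triangle\<close>

text \<open>Extracts from the set of all comparison pairs the case needed for branching: one point
  on the first side and one on the third.\<close>

lemma CAT_inequality_firstD:
  assumes "CAT_inequality \<kappa> d x y z a b c"
    and "geodesic_triangle (model_plane \<kappa>) (model_dist \<kappa>) x' y' z' a' b' c'"
    and "model_dist \<kappa> x' y' = d x y" "model_dist \<kappa> y' z' = d y z" "model_dist \<kappa> z' x' = d z x"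
    and "s \<in> {0..d x y}" "t \<in> {0..d z x}"
  shows "d (a s) (c t) \<le> model_dist \<kappa> (a' s) (c' t)"
proof -
  let ?S = "(\<lambda>s. (a s, a' s)) ` {0..d x y} \<union> (\<lambda>s. (b s, b' s)) ` {0..d y z} \<union>
    (\<lambda>s. (c s, c' s)) ` {0..d z x}"
  have "\<forall>(u, u')\<in>?S. \<forall>(v, v')\<in>?S. d u v \<le> model_dist \<kappa> u' v'"
    by (rule assms(1)[unfolded CAT_inequality_def Let_def, THEN spec, THEN spec, THEN spec,
          THEN spec, THEN spec, THEN spec, THEN mp]) (intro conjI, (rule assms)+)
  moreover have "(a s, a' s) \<in> ?S" using assms(6) by blast
  ultimately have "case (a s, a' s) of (u, u') \<Rightarrow> \<forall>(v, v')\<in>?S. d u v \<le> model_dist \<kappa> u' v'"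
    by (rule bspec)
  then have row: "\<forall>(v, v')\<in>?S. d (a s) v \<le> model_dist \<kappa> (a' s) v'"
    by (simp only: prod.case)
  have "(c t, c' t) \<in> ?S" using assms(7) by blast
  from bspec[OF row this] show ?thesis by (simp only: prod.case)
qed

text \<open>The contradiction comes from the degenerate triangle with vertices \<open>x\<close>, \<open>y\<close>, \<open>y\<close>.\<close>

lemma not_CAT_if_branching_geodesics:
  assumes a: "geodesic X d x y a" and c: "geodesic X d y x c"
    and sym: "d y x = d x y" and refl: "d y y = 0"
    and s: "s \<in> {0..d x y}" and far: "d (a s) (c (d x y - s)) > 0"
    and D: "ereal (d x y) < model_diameter \<kappa>"
  shows "\<not> CAT \<kappa> X d"
proof
  assume CAT: "CAT \<kappa> X d"
  define D where "D = d x y"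
  have D0: "0 \<le> D" using s by (simp add: D_def)
  have xy: "x \<in> X" "y \<in> X"
    using a D0 unfolding geodesic_def D_def by force+
  have b: "geodesic X d y y (\<lambda>_. y)"
    using xy refl by (simp add: geodesic_def)
  obtain \<gamma> where \<gamma>: "\<And>s. \<gamma> s \<in> model_plane \<kappa>"
    "\<And>s t. s \<in> {0..D} \<Longrightarrow> t \<in> {0..D} \<Longrightarrow> model_dist \<kappa> (\<gamma> s) (\<gamma> t) = \<bar>s - t\<bar>"
    using model_plane_geodesic_exists[of D \<kappa>] assms(7) unfolding D_def by metis
  \<comment> \<open>The degenerate triangle has perimeter \<open>2 * D\<close>, which must be below
    twice the model diameter.\<close>
  have "ereal D + ereal D < model_diameter \<kappa> + model_diameter \<kappa>"
    using D by (intro ereal_add_strict_mono2) (simp_all add: D_def)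
  then have per: "ereal (d x y + d y y + d y x) < 2 * model_diameter \<kappa>"
    by (simp add: sym refl D_def model_diameter_def split: if_splits)
  have "geodesic_triangle X d x y y a (\<lambda>_. y) c"
    using xy a b c by (simp add: geodesic_triangle_def)
  then have cmp: "CAT_inequality \<kappa> d x y y a (\<lambda>_. y) c"
    using CAT per unfolding CAT_def by blast
  \<comment> \<open>The third comparison side is the first one run backwards.\<close>
  have rev: "model_dist \<kappa> (\<gamma> (D - s)) (\<gamma> (D - t)) = \<bar>s - t\<bar>"
    if "s \<in> {0..D}" "t \<in> {0..D}" for s t
    using \<gamma>(2)[of "D - s" "D - t"] that by simp
  have "geodesic_triangle (model_plane \<kappa>) (model_dist \<kappa>) (\<gamma> 0) (\<gamma> D) (\<gamma> D)
      \<gamma> (\<lambda>_. \<gamma> D) (\<lambda>s. \<gamma> (D - s))"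
    using \<gamma>(1) \<gamma>(2)[of 0 D] \<gamma>(2)[of D D] \<gamma>(2)[of D 0] \<gamma>(2) rev D0
    unfolding geodesic_triangle_def geodesic_def by simp
  \<comment> \<open>The points at \<open>s\<close> on the first side and at \<open>D - s\<close> on
    the third side have the same comparison point \<open>\<gamma> s\<close>, so the right-hand side
    is 0.\<close>
  from CAT_inequality_firstD[OF cmp this, of s "D - s"]
  have "d (a s) (c (D - s)) \<le> model_dist \<kappa> (\<gamma> s) (\<gamma> (D - (D - s)))"
    using D0 s \<gamma>(2)[of 0 D] \<gamma>(2)[of D D] \<gamma>(2)[of D 0] by (simp add: D_def sym refl)
  then show False
    using far s \<gamma>(2)[of s s] by (simp add: D_def)
qed

section \<open>Transport cost of couplings\<close>

text \<open>The quantity minimised in \<open>wasserstein_dist\<close>, before the root is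
  taken.\<close>

definition transport_cost :: "ennreal \<Rightarrow> ('a::euclidean_space \<times> 'a) measure \<Rightarrow> ennreal"
  where "transport_cost p \<gamma> =
    (if p = \<infinity> then esssup \<gamma> (\<lambda>(x, y). ennreal (norm (x - y)))
     else \<integral>\<^sup>+(x, y). ennreal (norm (x - y) powr enn2real p) \<partial>\<gamma>)"

text \<open>The cost of moving a positive mass \<open>m\<close> over a distance \<open>c\<close>; an
  essential supremum does not see the amount of mass.\<close>

definition displacement_cost :: "ennreal \<Rightarrow> real \<Rightarrow> real \<Rightarrow> ennreal"
  where "displacement_cost p m c =
    (if p = \<infinity> then ennreal c else ennreal (m * c powr enn2real p))"

text \<open>Taking the root turns \<open>displacement_cost p m c\<close> into
  \<open>mass_factor p m * c\<close>, which is linear in \<open>c\<close> for every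
  \<open>p\<close>. This lets all exponents be treated alike.\<close>

definition mass_factor :: "ennreal \<Rightarrow> real \<Rightarrow> real"
  where "mass_factor p m = (if p = \<infinity> then 1 else m powr (1 / enn2real p))"

lemma mass_factor_1 [simp]: "mass_factor p 1 = 1"
  by (simp add: mass_factor_def)

lemma mass_factor_pos: "0 < m \<Longrightarrow> 0 < mass_factor p m"
  by (simp add: mass_factor_def)

lemma mass_factor_le_1: "0 \<le> m \<Longrightarrow> m \<le> 1 \<Longrightarrow> mass_factor p m \<le> 1"
  by (simp add: mass_factor_def powr_le1)

lemma enn2real_ge_1: "1 \<le> p \<Longrightarrow> p \<noteq> \<infinity> \<Longrightarrow> 1 \<le> enn2real p"
  by (cases p) (auto simp flip: ennreal_1)

lemma mass_displacement_root:
  assumes "1 \<le> q" "0 \<le> m" "0 \<le> c"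
  shows "(m * c powr q) powr (1 / q) = m powr (1 / q) * (c::real)"
  using assms by (simp add: powr_mult powr_powr)

lemma wasserstein_dist_le:
  assumes "1 \<le> p" "0 \<le> m" "0 \<le> c" "\<gamma> \<in> transport_plans \<mu> \<nu>"
    and "transport_cost p \<gamma> \<le> displacement_cost p m c"
  shows "wasserstein_dist p \<mu> \<nu> \<le> mass_factor p m * c"
proof -
  have le: "(INF \<gamma>\<in>transport_plans \<mu> \<nu>. transport_cost p \<gamma>) \<le> displacement_cost p m c"
    using assms by (intro INF_lower2)
  show ?thesis
  proof (cases "p = \<infinity>")
    case True
    then show ?thesis
      using le assms by (simp add: wasserstein_dist_def transport_cost_def displacement_cost_def
          mass_factor_def enn2real_leI)
  next
    case False
    have q: "1 \<le> enn2real p" using enn2real_ge_1 assms False by blast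
    have "enn2real (INF \<gamma>\<in>transport_plans \<mu> \<nu>. transport_cost p \<gamma>) \<le> m * c powr enn2real p"
      using le False assms by (intro enn2real_leI) (simp_all add: displacement_cost_def)
    then have "enn2real (INF \<gamma>\<in>transport_plans \<mu> \<nu>. transport_cost p \<gamma>) powr (1 / enn2real p)
        \<le> (m * c powr enn2real p) powr (1 / enn2real p)"
      using q by (intro powr_mono2) simp_all
    then show ?thesis
      using False q assms mass_displacement_root[of "enn2real p" m c]
      by (simp add: wasserstein_dist_def transport_cost_def mass_factor_def)
  qed
qed

text \<open>A plan of finite cost is required because \<open>enn2real\<close> sends
  \<open>\<infinity>\<close> to 0, so a lower bound would not survive an infinite infimum.\<close>

lemma wasserstein_dist_ge:
  assumes "1 \<le> p" "0 \<le> m" "0 \<le> c"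
    and lower: "\<And>\<gamma>. \<gamma> \<in> transport_plans \<mu> \<nu> \<Longrightarrow> displacement_cost p m c \<le> transport_cost p \<gamma>"
    and fin: "\<gamma> \<in> transport_plans \<mu> \<nu>" "transport_cost p \<gamma> < \<infinity>"
  shows "mass_factor p m * c \<le> wasserstein_dist p \<mu> \<nu>"
proof -
  let ?I = "INF \<gamma>\<in>transport_plans \<mu> \<nu>. transport_cost p \<gamma>"
  have le: "displacement_cost p m c \<le> ?I"
    using lower by (rule INF_greatest)
  have "?I \<le> transport_cost p \<gamma>" using fin by (intro INF_lower)
  then have I: "?I < top" using fin by (simp add: order_le_less_trans)
  have dc: "enn2real (displacement_cost p m c) \<le> enn2real ?I"
    using le I by (rule enn2real_mono)
  show ?thesis
  proof (cases "p = \<infinity>")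
    case True
    then show ?thesis
      using dc assms by (simp add: wasserstein_dist_def transport_cost_def displacement_cost_def
          mass_factor_def)
  next
    case False
    have q: "1 \<le> enn2real p" using enn2real_ge_1 assms False by blast
    have "m * c powr enn2real p \<le> enn2real ?I"
      using dc False assms by (simp add: displacement_cost_def)
    then have "(m * c powr enn2real p) powr (1 / enn2real p) \<le> enn2real ?I powr (1 / enn2real p)"
      using q assms by (intro powr_mono2) simp_all
    then show ?thesis
      using False q assms mass_displacement_root[of "enn2real p" m c]
      by (simp add: wasserstein_dist_def transport_cost_def mass_factor_def)
  qed
qed

section \<open>Couplings and bounds for their cost\<close>

lemma measurable_displacement [measurable]:
  "(\<lambda>(x, y). ennreal (norm (x - y))) \<in>
    borel_measurable (borel :: ('a::euclidean_space \<times> 'a) measure)"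
  "(\<lambda>(x, y). ennreal (norm (x - y) powr q)) \<in>
    borel_measurable (borel :: ('a::euclidean_space \<times> 'a) measure)"
  unfolding borel_prod[symmetric] by measurable

lemma measurable_displacement_cong:
  fixes \<gamma> :: "('a::euclidean_space \<times> 'a) measure"
  assumes "sets \<gamma> = sets borel"
  shows "(\<lambda>(x, y). ennreal (norm (x - y))) \<in> borel_measurable \<gamma>"
    and "(\<lambda>(x, y). ennreal (norm (x - y) powr q)) \<in> borel_measurable \<gamma>"
  using measurable_displacement by (simp_all add: measurable_cong_sets[OF assms refl])

text \<open>Two maps on a common probability space couple their laws. Every plan constructed below
  has this form.\<close>

lemma coupling_transport_plan:
  fixes f g :: "'b \<Rightarrow> 'a::euclidean_space"
  assumes "prob_space M" and [measurable]: "f \<in> borel_measurable M" "g \<in> borel_measurable M"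
  shows "distr M borel (\<lambda>x. (f x, g x)) \<in> transport_plans (distr M borel f) (distr M borel g)"
proof -
  interpret prob_space M by fact
  have "(\<lambda>x. (f x, g x)) \<in> M \<rightarrow>\<^sub>M (borel :: ('a \<times> 'a) measure)"
    by measurable
  moreover have "fst \<in> (borel :: ('a \<times> 'a) measure) \<rightarrow>\<^sub>M borel"
      "snd \<in> (borel :: ('a \<times> 'a) measure) \<rightarrow>\<^sub>M borel"
    by (simp_all flip: borel_prod)
  ultimately show ?thesis
    by (simp add: transport_plans_def borel_prob_def prob_space_distr distr_distr comp_def)
qed

text \<open>Nothing moves outside \<open>A\<close> and nothing moves farther than \<open>c\<close>,
  so only the mass of \<open>A\<close> contributes.\<close>

lemma coupling_transport_cost_le:
  fixes f g :: "'b \<Rightarrow> 'a::euclidean_space"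
  assumes p: "1 \<le> p" and "prob_space M"
    and [measurable]: "f \<in> borel_measurable M" "g \<in> borel_measurable M" "A \<in> sets M"
    and c: "0 \<le> c" and le: "\<And>x. x \<in> space M \<Longrightarrow> norm (f x - g x) \<le> c * indicator A x"
  shows "transport_cost p (distr M borel (\<lambda>x. (f x, g x))) \<le> displacement_cost p (measure M A) c"
proof -
  interpret prob_space M by fact
  have fg [measurable]: "(\<lambda>x. (f x, g x)) \<in> M \<rightarrow>\<^sub>M (borel :: ('a \<times> 'a) measure)"
    by measurable
  show ?thesis
  proof (cases "p = \<infinity>")
    case True
    have "AE x in M. ennreal (norm (f x - g x)) \<le> ennreal c"
    proof (rule AE_I2)
      fix x assume "x \<in> space M"
      from le[OF this] have "norm (f x - g x) \<le> c"
        using c by (cases "x \<in> A") auto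
      then show "ennreal (norm (f x - g x)) \<le> ennreal c" by (rule ennreal_leI)
    qed
    then have "AE z in distr M borel (\<lambda>x. (f x, g x)). (case z of (x, y) \<Rightarrow> ennreal (norm (x - y))) \<le> ennreal c"
      by (subst AE_distr_iff) simp_all
    then have "esssup (distr M borel (\<lambda>x. (f x, g x))) (\<lambda>(x, y). ennreal (norm (x - y))) \<le> ennreal c"
      by (intro esssup_I measurable_displacement_cong) simp_all
    then show ?thesis using True by (simp add: transport_cost_def displacement_cost_def)
  next
    case False
    define q where "q = enn2real p"
    have q: "1 \<le> q" using enn2real_ge_1 p False by (simp add: q_def)
    have "(\<integral>\<^sup>+(x, y). ennreal (norm (x - y) powr q) \<partial>distr M borel (\<lambda>x. (f x, g x)))
        = (\<integral>\<^sup>+x. ennreal (norm (f x - g x) powr q) \<partial>M)"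
      by (subst nn_integral_distr) simp_all
    also have "\<dots> \<le> (\<integral>\<^sup>+x. ennreal (c powr q) * indicator A x \<partial>M)"
    proof (rule nn_integral_mono)
      fix x assume "x \<in> space M"
      from le[OF this] show "ennreal (norm (f x - g x) powr q) \<le> ennreal (c powr q) * indicator A x"
        using q by (cases "x \<in> A") (auto intro!: ennreal_leI powr_mono2)
    qed
    also have "\<dots> = ennreal (measure M A * c powr q)"
      by (subst nn_integral_cmult_indicator)
        (simp_all add: emeasure_eq_measure ennreal_mult mult.commute)
    finally show ?thesis using False by (simp add: transport_cost_def displacement_cost_def q_def)
  qed
qed

text \<open>A bound of Markov type: all mass starting in \<open>B\<close> travels at least
  \<open>c\<close>. For \<open>p = \<infinity>\<close> it suffices that this mass is
  positive.\<close>

lemma transport_cost_ge: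
  fixes \<mu> \<nu> :: "'a::euclidean_space measure"
  assumes plan: "\<gamma> \<in> transport_plans \<mu> \<nu>"
    and B: "B \<in> sets borel" "0 < measure \<mu> B"
    and far: "AE z in \<gamma>. fst z \<in> B \<longrightarrow> c \<le> norm (fst z - snd z)" and c: "0 \<le> c"
  shows "displacement_cost p (measure \<mu> B) c \<le> transport_cost p \<gamma>"
proof -
  have \<gamma>: "prob_space \<gamma>" "sets \<gamma> = sets borel" "distr \<gamma> borel fst = \<mu>"
    using plan by (auto simp: transport_plans_def borel_prob_def)
  interpret prob_space \<gamma> by fact
  have sp: "space \<gamma> = UNIV" using sets_eq_imp_space_eq[OF \<gamma>(2)] by simp
  have fst[measurable]: "fst \<in> \<gamma> \<rightarrow>\<^sub>M (borel :: 'a measure)"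
    by (simp add: measurable_cong_sets[OF \<gamma>(2) refl] flip: borel_prod)
  define A where "A = fst -` B \<inter> space \<gamma>"
  have A[measurable]: "A \<in> sets \<gamma>" unfolding A_def using B(1) by measurable
  have mA: "measure \<gamma> A = measure \<mu> B"
    unfolding \<gamma>(3)[symmetric] A_def by (rule measure_distr[symmetric]) (use B in simp_all)
  show ?thesis
  proof (cases "p = \<infinity>")
    case True
    let ?e = "esssup \<gamma> (\<lambda>(x, y). ennreal (norm (x - y)))"
    have "ennreal c \<le> ?e"
    proof (rule ccontr)
      assume less: "\<not> ennreal c \<le> ?e"
      \<comment> \<open>If the essential supremum were below \<open>c\<close>, almost no mass would
        start in \<open>B\<close>.\<close>
      have "AE z in \<gamma>. z \<notin> A"
        using far esssup_AE[of "\<lambda>(x, y). ennreal (norm (x - y))" \<gamma>]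
      proof eventually_elim
        case (elim z)
        show ?case
        proof
          assume "z \<in> A"
          then have "c \<le> norm (fst z - snd z)" using elim(1) by (simp add: A_def)
          then have "ennreal c \<le> ennreal (norm (fst z - snd z))" by (rule ennreal_leI)
          also have "\<dots> \<le> ?e" using elim(2) by (simp add: case_prod_beta)
          finally show False using less by simp
        qed
      qed
      then have "measure \<gamma> A = 0" by (simp add: prob_eq_0)
      with mA B show False by simp
    qed
    then show ?thesis using True by (simp add: transport_cost_def displacement_cost_def)
  next
    case False
    define q where "q = enn2real p"
    have q: "0 \<le> q" by (simp add: q_def)
    have "ennreal (measure \<mu> B * c powr q) = (\<integral>\<^sup>+z. ennreal (c powr q) * indicator A z \<partial>\<gamma>)"
      by (subst nn_integral_cmult_indicator)
        (simp_all add: emeasure_eq_measure ennreal_mult mult.commute mA)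
    also have "\<dots> \<le> (\<integral>\<^sup>+(x, y). ennreal (norm (x - y) powr q) \<partial>\<gamma>)"
      using far
    proof (intro nn_integral_mono_AE, eventually_elim)
      case (elim z)
      then show ?case
        using q c by (cases "z \<in> A") (auto simp: A_def case_prod_beta intro!: ennreal_leI powr_mono2)
    qed
    finally show ?thesis using False by (simp add: transport_cost_def displacement_cost_def q_def)
  qed
qed

lemma wasserstein_dist_coupling_le:
  fixes f g :: "'b \<Rightarrow> 'a::euclidean_space"
  assumes "1 \<le> p" and "prob_space M"
    and "f \<in> borel_measurable M" "g \<in> borel_measurable M"
    and "0 \<le> c" and "\<And>x. x \<in> space M \<Longrightarrow> norm (f x - g x) \<le> c"
  shows "wasserstein_dist p (distr M borel f) (distr M borel g) \<le> c"
proof -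
  interpret prob_space M by fact
  \<comment> \<open>With the whole space as the moving set, the mass is 1 and so is the mass
    factor.\<close>
  have "transport_cost p (distr M borel (\<lambda>x. (f x, g x)))
      \<le> displacement_cost p (measure M (space M)) c"
    using assms by (intro coupling_transport_cost_le) simp_all
  then show ?thesis
    using wasserstein_dist_le[OF \<open>1 \<le> p\<close> _ \<open>0 \<le> c\<close> coupling_transport_plan[OF assms(2-4)], of 1]
    by (simp add: prob_space)
qed

section \<open>Stability of the carrier under bounded perturbations\<close>

text \<open>Bounding a sum by twice the maximum gives
  \<open>(s + t) powr q \<le> 2 powr q * (s powr q + t powr q)\<close> for nonnegative
  \<open>s\<close>, \<open>t\<close>; the constant term is integrable because the total mass is
  1.\<close>

lemma (in prob_space) nn_integral_powr_norm_add_finite: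
  fixes f g :: "'a \<Rightarrow> 'b::euclidean_space"
  assumes [measurable]: "f \<in> borel_measurable M"
    and q: "0 \<le> q" and C: "0 \<le> C" and near: "\<And>x. x \<in> space M \<Longrightarrow> norm (f x - g x) \<le> C"
    and fin: "(\<integral>\<^sup>+x. ennreal (norm (f x) powr q) \<partial>M) < \<infinity>"
  shows "(\<integral>\<^sup>+x. ennreal (norm (g x) powr q) \<partial>M) < \<infinity>"
proof -
  have "(\<integral>\<^sup>+x. ennreal (norm (g x) powr q) \<partial>M) \<le>
      (\<integral>\<^sup>+x. ennreal (2 powr q) * (ennreal (norm (f x) powr q) + ennreal (C powr q)) \<partial>M)"
  proof (rule nn_integral_mono)
    fix x assume "x \<in> space M"
    then have "norm (g x) \<le> norm (f x) + C"
      using near norm_triangle_sub[of "g x" "f x"] by (fastforce simp: norm_minus_commute)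
    then have "norm (g x) powr q \<le> (2 * max (norm (f x)) C) powr q"
      using q by (intro powr_mono2) auto
    also have "\<dots> = 2 powr q * max (norm (f x)) C powr q"
      using C by (simp add: powr_mult)
    also have "\<dots> \<le> 2 powr q * (norm (f x) powr q + C powr q)"
      by (intro mult_left_mono) (auto simp: max_def)
    finally show "ennreal (norm (g x) powr q) \<le>
        ennreal (2 powr q) * (ennreal (norm (f x) powr q) + ennreal (C powr q))"
      by (simp add: ennreal_leI flip: ennreal_plus ennreal_mult)
  qed
  also have "\<dots> = ennreal (2 powr q) *
      ((\<integral>\<^sup>+x. ennreal (norm (f x) powr q) \<partial>M) + ennreal (C powr q))"
    by (simp add: nn_integral_cmult nn_integral_add emeasure_space_1)
  also have "\<dots> < \<infinity>"
    using fin by (simp add: ennreal_mult_less_top)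
  finally show ?thesis .
qed

text \<open>The complement of the support is the union of all open null sets, and by Lindelof
  countably many of them already have this union.\<close>

lemma AE_measure_support:
  fixes \<mu> :: "'a::second_countable_topology measure"
  assumes "sets \<mu> = sets borel"
  shows "AE x in \<mu>. x \<in> measure_support \<mu>"
proof -
  let ?F = "{U. open U \<and> emeasure \<mu> U = 0}"
  obtain F where F: "F \<subseteq> ?F" "countable F" "\<Union>F = \<Union>?F"
    using Lindelof[of ?F] by blast
  have "\<Union>F \<in> null_sets \<mu>"
    using F(1) assms by (intro null_sets_UN' [where N = id, simplified] F(2)) (auto simp: null_sets_def)
  moreover have "x \<in> \<Union>F" if "x \<notin> measure_support \<mu>" for x
    using that unfolding F(3) measure_support_def by auto
  ultimately show ?thesis
    by (intro AE_I'[of "\<Union>F"]) auto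
qed

text \<open>Almost sure boundedness is easier to carry through image measures than boundedness of
  the support. Conversely, the complement of a closed ball of full measure is an open null set and
  so misses the support.\<close>

lemma wasserstein_carrier_infinity_iff:
  fixes \<mu> :: "'a::euclidean_space measure"
  assumes "borel_prob \<mu>"
  shows "\<mu> \<in> wasserstein_carrier \<infinity> \<longleftrightarrow> (\<exists>R. AE x in \<mu>. norm x \<le> R)"
proof
  have \<mu>: "sets \<mu> = sets borel" using assms by (simp add: borel_prob_def)
  {
    assume "\<mu> \<in> wasserstein_carrier \<infinity>"
    then obtain R where "\<And>x. x \<in> measure_support \<mu> \<Longrightarrow> norm x \<le> R"
      by (auto simp: wasserstein_carrier_def bounded_iff)
    then show "\<exists>R. AE x in \<mu>. norm x \<le> R"
      using AE_measure_support[OF \<mu>] by (intro exI[of _ R]) auto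
  next
    assume "\<exists>R. AE x in \<mu>. norm x \<le> R"
    then obtain R where R: "AE x in \<mu>. norm x \<le> R" by blast
    have "norm x \<le> R" if "x \<in> measure_support \<mu>" for x
    proof (rule ccontr)
      assume x: "\<not> norm x \<le> R"
      have "open (- cball 0 R :: 'a set)" by (simp add: open_Compl)
      then have "emeasure \<mu> (- cball 0 R) > 0"
        using that x by (auto simp: measure_support_def)
      moreover have "emeasure \<mu> (- cball 0 R) = 0"
      proof (rule AE_iff_measurable[THEN iffD1, OF _ _ R])
        show "- cball 0 R \<in> sets \<mu>" by (simp add: \<mu>)
        show "{x \<in> space \<mu>. \<not> norm x \<le> R} = - cball 0 R"
          using sets_eq_imp_space_eq[OF \<mu>] by auto
      qed
      ultimately show False by simp
    qed
    then show "\<mu> \<in> wasserstein_carrier \<infinity>"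
      using assms by (auto simp: wasserstein_carrier_def bounded_iff)
  }
qed

lemma wasserstein_carrier_perturb:
  fixes f g :: "'b \<Rightarrow> 'a::euclidean_space"
  assumes "prob_space M" and [measurable]: "f \<in> borel_measurable M" "g \<in> borel_measurable M"
    and C: "0 \<le> C" and near: "\<And>x. x \<in> space M \<Longrightarrow> norm (f x - g x) \<le> C"
    and mem: "distr M borel f \<in> wasserstein_carrier p"
  shows "distr M borel g \<in> wasserstein_carrier p"
proof -
  interpret prob_space M by fact
  have prob: "borel_prob (distr M borel f)" "borel_prob (distr M borel g)"
    by (simp_all add: borel_prob_def prob_space_distr)
  show ?thesis
  proof (cases "p = \<infinity>")
    case True
    then obtain R where "AE x in distr M borel f. norm x \<le> R"
      using mem wasserstein_carrier_infinity_iff[OF prob(1)] by auto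
    then have "AE x in M. norm (f x) \<le> R" by (simp add: AE_distr_iff)
    then have "AE x in M. norm (g x) \<le> R + C"
    proof (rule AE_mp, intro AE_I2 impI)
      fix x assume "x \<in> space M" "norm (f x) \<le> R"
      then show "norm (g x) \<le> R + C"
        using near[of x] norm_triangle_sub[of "g x" "f x"] by (simp add: norm_minus_commute)
    qed
    then have "AE x in distr M borel g. norm x \<le> R + C" by (simp add: AE_distr_iff)
    then show ?thesis using True wasserstein_carrier_infinity_iff[OF prob(2)] by auto
  next
    case False
    then show ?thesis
      using mem prob nn_integral_powr_norm_add_finite[of f "enn2real p" C g] C near
      by (simp add: wasserstein_carrier_def nn_integral_distr)
  qed
qed


section \<open>Splitting an atom of a rounded measure\<close>

text \<open>\<open>T\<close> stands for the rounding map and \<open>z\<close> for a value that it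
  takes with positive probability; the other values of \<open>T\<close> stay
  \<open>\<epsilon>\<close> away from \<open>z\<close>.\<close>

locale split_atom = prob_space \<mu>
  for \<mu> :: "'a::euclidean_space measure" +
  fixes T :: "'a \<Rightarrow> 'a" and z :: 'a and \<epsilon> :: real
  assumes sets_\<mu> [simp, measurable_cong]: "sets \<mu> = sets borel"
    and T_borel: "T \<in> borel_measurable borel"
    and \<epsilon>_pos: "0 < \<epsilon>"
    and separated: "T x \<noteq> z \<Longrightarrow> \<epsilon> \<le> dist (T x) z"
    and atom: "0 < measure \<mu> {x. T x = z}"
begin

lemma T_measurable [measurable]: "T \<in> borel_measurable \<mu>"
  using T_borel by (simp add: measurable_cong_sets[OF sets_\<mu> refl])

lemma space_\<mu> [simp]: "space \<mu> = UNIV"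
  using sets_eq_imp_space_eq[OF sets_\<mu>] by simp

definition weight :: real
  where "weight = measure \<mu> {x. T x = z}"

definition coin :: "bool measure"
  where "coin = measure_pmf (bernoulli_pmf (1 / 2))"

text \<open>The coin \<open>h\<close> chooses the half. All split measures are images of the same
  product space, so any two of them are coupled by using the same point and the same coin.\<close>

definition split_map :: "'a \<Rightarrow> 'a \<times> bool \<Rightarrow> 'a"
  where "split_map u = (\<lambda>(x, h). if T x = z then (if h then z + u else z - u) else T x)"

definition split_measure :: "'a \<Rightarrow> 'a measure"
  where "split_measure u = distr (\<mu> \<Otimes>\<^sub>M coin) borel (split_map u)"

lemma sets_coin [simp, measurable_cong]: "sets coin = sets (count_space UNIV)"
  by (simp add: coin_def)

lemma prob_space_coin: "prob_space coin"
  by (simp add: coin_def prob_space_measure_pmf)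

sublocale coin: prob_space coin by (rule prob_space_coin)

sublocale M: pair_prob_space \<mu> coin ..

lemma space_pair [simp]: "space (\<mu> \<Otimes>\<^sub>M coin) = UNIV"
  by (simp add: space_pair_measure coin_def)

lemma split_map_measurable [measurable]: "split_map u \<in> borel_measurable (\<mu> \<Otimes>\<^sub>M coin)"
  unfolding split_map_def by measurable

lemma atom_sets [measurable]: "{x. T x = z} \<in> sets \<mu>"
proof -
  have "{x \<in> space \<mu>. T x = z} \<in> sets \<mu>" by measurable
  then show ?thesis by simp
qed

lemma atom_pair_sets [measurable]: "{\<omega>. T (fst \<omega>) = z} \<in> sets (\<mu> \<Otimes>\<^sub>M coin)"
proof -
  have "{\<omega> \<in> space (\<mu> \<Otimes>\<^sub>M coin). T (fst \<omega>) = z} \<in> sets (\<mu> \<Otimes>\<^sub>M coin)" by measurable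
  then show ?thesis by simp
qed

lemma measure_atom_pair: "measure (\<mu> \<Otimes>\<^sub>M coin) {\<omega>. T (fst \<omega>) = z} = weight"
proof -
  have "{\<omega>. T (fst \<omega>) = z} = {x. T x = z} \<times> space coin"
    by (auto simp: coin_def)
  then have "emeasure (\<mu> \<Otimes>\<^sub>M coin) {\<omega>. T (fst \<omega>) = z} = emeasure \<mu> {x. T x = z}"
    by (simp add: coin.emeasure_pair_measure_Times coin.emeasure_space_1)
  then show ?thesis by (simp add: measure_def weight_def)
qed

lemma weight_pos: "0 < weight" and weight_le_1: "weight \<le> 1"
  using atom by (simp_all add: weight_def)

text \<open>Flipping a fair coin preserves its law and exchanges \<open>z + u\<close> with
  \<open>z - u\<close>. This identification is the source of branching.\<close>

lemma split_measure_minus: "split_measure (- u) = split_measure u"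
proof -
  have "map_pmf Not (bernoulli_pmf (1 / 2)) = bernoulli_pmf (1 / 2)"
  proof (rule pmf_eqI)
    fix i
    have "Not -` {i} = {\<not> i}" by auto
    then show "pmf (map_pmf Not (bernoulli_pmf (1 / 2))) i = pmf (bernoulli_pmf (1 / 2)) i"
      by (cases i) (simp_all add: pmf_map measure_pmf_single)
  qed
  then have "distr coin (count_space UNIV) Not = coin"
    unfolding coin_def by (metis map_pmf_rep_eq)
  moreover have "distr coin coin Not = distr coin (count_space UNIV) Not"
    by (rule distr_cong) simp_all
  ultimately have flip: "distr coin coin Not = coin" by simp
  have "\<mu> \<Otimes>\<^sub>M coin = distr (\<mu> \<Otimes>\<^sub>M coin) (\<mu> \<Otimes>\<^sub>M coin) (\<lambda>(x, h). (x, \<not> h))"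
    using pair_measure_distr[of "\<lambda>x. x" \<mu> \<mu> Not coin coin] coin.sigma_finite_measure_axioms
    by (simp add: flip)
  then have "split_measure (- u) = distr (distr (\<mu> \<Otimes>\<^sub>M coin) (\<mu> \<Otimes>\<^sub>M coin) (\<lambda>(x, h). (x, \<not> h))) borel (split_map (- u))"
    by (simp add: split_measure_def)
  also have "\<dots> = distr (\<mu> \<Otimes>\<^sub>M coin) borel (split_map (- u) \<circ> (\<lambda>(x, h). (x, \<not> h)))"
  proof (rule distr_distr)
    have "Not \<in> coin \<rightarrow>\<^sub>M coin" by (simp add: measurable_def coin_def)
    then show "(\<lambda>(x, h). (x, \<not> h)) \<in> (\<mu> \<Otimes>\<^sub>M coin) \<rightarrow>\<^sub>M (\<mu> \<Otimes>\<^sub>M coin)"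
      unfolding case_prod_beta
      by (intro measurable_Pair measurable_fst measurable_compose[OF measurable_snd])
  qed (rule split_map_measurable)
  also have "split_map (- u) \<circ> (\<lambda>(x, h). (x, \<not> h)) = split_map u"
    by (auto simp: split_map_def fun_eq_iff)
  finally show ?thesis by (simp add: split_measure_def)
qed

section \<open>Distances between split measures\<close>

text \<open>Both halves of the atom lie in the ball, and every other value of \<open>T\<close> lies
  outside it.\<close>

lemma measure_split_measure_ball:
  assumes "norm u < \<epsilon>"
  shows "measure (split_measure u) (ball z \<epsilon>) = weight"
proof -
  have "split_map u -` ball z \<epsilon> = {\<omega>. T (fst \<omega>) = z}"
    using assms separated by (force simp: split_map_def dist_norm norm_minus_commute split: if_splits)
  then show ?thesis
    by (simp add: split_measure_def measure_distr measure_atom_pair)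
qed

lemma AE_split_measure:
  "AE x in split_measure u. x = z + u \<or> x = z - u \<or> \<epsilon> \<le> dist x z"
proof -
  have "{x. x = z + u \<or> x = z - u \<or> \<epsilon> \<le> dist x z} \<in> sets borel"
    by measurable
  then show ?thesis
    unfolding split_measure_def using separated
    by (subst AE_distr_iff) (auto intro!: AE_I2 simp: split_map_def split: if_splits)
qed

text \<open>Every plan has to move the mass at \<open>z \<plusminus> u\<close> to \<open>z \<plusminus> v\<close> or to a point at distance at
  least \<open>\<epsilon>\<close> from \<open>z\<close>; as \<open>u \<bullet> v \<ge> 0\<close>, no such point is closer than \<open>norm (u - v)\<close>.\<close>

lemma wasserstein_dist_split_measure:
  assumes p: "1 \<le> p" and uv: "0 \<le> u \<bullet> v" and u: "norm u \<le> \<epsilon> / 3" and v: "norm v \<le> \<epsilon> / 3"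
  shows "wasserstein_dist p (split_measure u) (split_measure v) = mass_factor p weight * norm (u - v)"
proof (rule antisym)
  let ?\<gamma> = "distr (\<mu> \<Otimes>\<^sub>M coin) borel (\<lambda>\<omega>. (split_map u \<omega>, split_map v \<omega>))"
  have plan: "?\<gamma> \<in> transport_plans (split_measure u) (split_measure v)"
    unfolding split_measure_def
    by (intro coupling_transport_plan M.prob_space_axioms split_map_measurable)
  \<comment> \<open>With a common coin the halves move by \<open>u - v\<close> or its negative, and
    nothing moves off the atom.\<close>
  have cost: "transport_cost p ?\<gamma> \<le> displacement_cost p weight (norm (u - v))"
    unfolding measure_atom_pair[symmetric]
    by (intro coupling_transport_cost_le p M.prob_space_axioms split_map_measurable atom_pair_sets)
      (auto simp: split_map_def norm_minus_commute)
  show "wasserstein_dist p (split_measure u) (split_measure v) \<le> mass_factor p weight * norm (u - v)"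
    using weight_pos by (intro wasserstein_dist_le[OF p _ _ plan cost]) simp_all
  show "mass_factor p weight * norm (u - v) \<le> wasserstein_dist p (split_measure u) (split_measure v)"
  proof (rule wasserstein_dist_ge[OF p _ _ _ plan])
    show "transport_cost p ?\<gamma> < \<infinity>"
      using cost by (rule order_le_less_trans) (simp add: displacement_cost_def)
    fix \<gamma> assume \<gamma>: "\<gamma> \<in> transport_plans (split_measure u) (split_measure v)"
    then have \<gamma>': "sets \<gamma> = sets borel" "split_measure u = distr \<gamma> borel fst"
      "split_measure v = distr \<gamma> borel snd"
      by (auto simp: transport_plans_def borel_prob_def)
    have [measurable]: "fst \<in> \<gamma> \<rightarrow>\<^sub>M (borel :: 'a measure)" "snd \<in> \<gamma> \<rightarrow>\<^sub>M (borel :: 'a measure)"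
      by (simp_all add: measurable_cong_sets[OF \<gamma>'(1) refl] flip: borel_prod)
    have fst: "AE \<omega> in \<gamma>. fst \<omega> = z + u \<or> fst \<omega> = z - u \<or> \<epsilon> \<le> dist (fst \<omega>) z"
      using AE_split_measure[of u] unfolding \<gamma>'(2) by (subst (asm) AE_distr_iff) measurable
    have snd: "AE \<omega> in \<gamma>. snd \<omega> = z + v \<or> snd \<omega> = z - v \<or> \<epsilon> \<le> dist (snd \<omega>) z"
      using AE_split_measure[of v] unfolding \<gamma>'(3) by (subst (asm) AE_distr_iff) measurable
    \<comment> \<open>The sign of the inner product makes \<open>u - v\<close> no longer than
      \<open>u + v\<close>, so sending \<open>z + u\<close> to \<open>z + v\<close> is at least as
      short as sending it to \<open>z - v\<close>.\<close>
    have "(norm (u - v))\<^sup>2 \<le> (norm (u + v))\<^sup>2"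
      using uv by (simp add: power2_norm_eq_inner inner_diff inner_add inner_commute)
    then have sum: "norm (u - v) \<le> norm (u + v)"
      by (rule power2_le_imp_le) simp
    \<comment> \<open>Here \<open>norm (u - v) \<le> 2 * \<epsilon> / 3\<close>, while the distance
      from \<open>a\<close> to \<open>y\<close> is at least
      \<open>\<epsilon> - \<epsilon> / 3\<close>; this is what the bound
      \<open>\<epsilon> / 3\<close> is for.\<close>
    have far: "norm (u - v) \<le> norm (a - y)"
      if "a = u \<or> a = - u" "\<epsilon> \<le> norm y" for a y :: 'a
      using that u v norm_triangle_ineq4[of u v] norm_triangle_ineq2[of y a]
      by (auto simp: norm_minus_commute)
    have "AE \<omega> in \<gamma>. fst \<omega> \<in> ball z \<epsilon> \<longrightarrow> norm (u - v) \<le> norm (fst \<omega> - snd \<omega>)"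
      using fst snd
    proof eventually_elim
      case (elim \<omega>)
      show ?case
      proof
        assume "fst \<omega> \<in> ball z \<epsilon>"
        then have a: "fst \<omega> - z = u \<or> fst \<omega> - z = - u"
          using elim(1) by (auto simp: dist_commute)
        from elim(2) have "snd \<omega> - z = v \<or> snd \<omega> - z = - v \<or> \<epsilon> \<le> norm (snd \<omega> - z)"
          by (auto simp: dist_norm)
        then have "norm (u - v) \<le> norm ((fst \<omega> - z) - (snd \<omega> - z))"
        proof (elim disjE)
          assume "\<epsilon> \<le> norm (snd \<omega> - z)"
          with a show ?thesis by (rule far)
        next
          assume "snd \<omega> - z = v"
          with a sum show ?thesis
            using norm_minus_cancel[of "u + v"] by auto
        next
          assume "snd \<omega> - z = - v"
          with a sum show ?thesis
            using norm_minus_commute[of u v] by auto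
        qed
        then show "norm (u - v) \<le> norm (fst \<omega> - snd \<omega>)" by simp
      qed
    qed
    moreover have "measure (split_measure u) (ball z \<epsilon>) = weight"
      using u \<epsilon>_pos by (intro measure_split_measure_ball) linarith
    ultimately show "displacement_cost p weight (norm (u - v)) \<le> transport_cost p \<gamma>"
      using transport_cost_ge[OF \<gamma>, of "ball z \<epsilon>" "norm (u - v)" p] weight_pos by simp
  qed (use weight_pos in simp_all)
qed

text \<open>Couple a point with the image of its rounding under splitting: rounding moves it by at
  most \<open>\<delta>\<close>, splitting by at most \<open>norm u\<close>.\<close>

lemma dist_split_measure_le:
  assumes p: "1 \<le> p" and near: "\<And>x. norm (x - T x) \<le> \<delta>"
  shows "wasserstein_dist p \<mu> (split_measure u) \<le> \<delta> + norm u"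
    and "\<mu> \<in> wasserstein_carrier p \<Longrightarrow> split_measure u \<in> wasserstein_carrier p"
proof -
  \<comment> \<open>The library fact has target \<open>\<mu>\<close>; the target may be replaced by
    \<open>borel\<close>, which has the same sets.\<close>
  have \<mu>: "distr (\<mu> \<Otimes>\<^sub>M coin) borel fst = \<mu>"
    using coin.distr_pair_fst[of \<mu>] by (metis distr_cong sets_\<mu>)
  have fst: "fst \<in> (\<mu> \<Otimes>\<^sub>M coin) \<rightarrow>\<^sub>M borel" by measurable
  have \<delta>: "0 \<le> \<delta> + norm u"
    using order_trans[OF norm_ge_zero near] by simp
  have le: "norm (fst \<omega> - split_map u \<omega>) \<le> \<delta> + norm u" for \<omega>
  proof -
    have "norm (fst \<omega> - split_map u \<omega>) \<le> norm (fst \<omega> - T (fst \<omega>)) + norm (T (fst \<omega>) - split_map u \<omega>)"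
      using norm_triangle_ineq[of "fst \<omega> - T (fst \<omega>)" "T (fst \<omega>) - split_map u \<omega>"] by simp
    also have "norm (T (fst \<omega>) - split_map u \<omega>) \<le> norm u"
      by (auto simp: split_map_def case_prod_beta)
    finally show ?thesis using near[of "fst \<omega>"] by simp
  qed
  show "wasserstein_dist p \<mu> (split_measure u) \<le> \<delta> + norm u"
    using wasserstein_dist_coupling_le[OF p M.prob_space_axioms fst split_map_measurable \<delta> le]
    by (simp add: \<mu> split_measure_def)
  show "\<mu> \<in> wasserstein_carrier p \<Longrightarrow> split_measure u \<in> wasserstein_carrier p"
    using wasserstein_carrier_perturb[OF M.prob_space_axioms fst split_map_measurable \<delta> le]
    by (simp add: \<mu> split_measure_def)
qed

section \<open>Two geodesics with the same endpoints\<close>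

text \<open>For orthogonal \<open>a\<close> and \<open>b\<close>, any two points of the segment
  between them have nonnegative inner product. The distance formula therefore applies along the
  whole segment, and \<open>u \<mapsto> split_measure u\<close> is a similarity there.\<close>

lemma geodesic_split_measure:
  assumes p: "1 \<le> p" and ab: "a \<bullet> b = 0" and a: "norm a \<le> \<epsilon> / 3" and b: "norm b \<le> \<epsilon> / 3"
    and "a \<noteq> b" and "\<And>u. norm u \<le> max (norm a) (norm b) \<Longrightarrow> split_measure u \<in> X"
  defines "D \<equiv> mass_factor p weight * norm (a - b)"
  shows "geodesic X (wasserstein_dist p) (split_measure a) (split_measure b)
    (\<lambda>s. split_measure (a + (s / D) *\<^sub>R (b - a)))"
proof -
  let ?u = "\<lambda>s. a + (s / D) *\<^sub>R (b - a)"
  have D: "0 < D" using weight_pos mass_factor_pos \<open>a \<noteq> b\<close> by (simp add: D_def)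
  have dab: "wasserstein_dist p (split_measure a) (split_measure b) = D"
    using wasserstein_dist_split_measure[OF p _ a b] ab by (simp add: D_def)
  have conv: "?u s = (1 - s / D) *\<^sub>R a + (s / D) *\<^sub>R b" for s
    by (simp add: algebra_simps)
  have norm: "norm (?u s) \<le> max (norm a) (norm b)" if "s \<in> {0..D}" for s
  proof -
    have s: "0 \<le> s / D" "s / D \<le> 1" using that D by auto
    have "norm (?u s) \<le> \<bar>1 - s / D\<bar> * norm a + \<bar>s / D\<bar> * norm b"
      unfolding conv norm_scaleR[symmetric] by (rule norm_triangle_ineq)
    also have "\<dots> = (1 - s / D) * norm a + (s / D) * norm b"
      using s by (simp only: abs_of_nonneg diff_ge_0_iff_ge)
    also have "\<dots> \<le> max (norm a) (norm b)"
      using s by (intro convex_bound_le) auto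
    finally show ?thesis .
  qed
  have "wasserstein_dist p (split_measure (?u s)) (split_measure (?u t)) = \<bar>s - t\<bar>"
    if st: "s \<in> {0..D}" "t \<in> {0..D}" for s t
  proof -
    \<comment> \<open>The mixed terms vanish by orthogonality, and the remaining coefficients are
      nonnegative.\<close>
    have "?u s \<bullet> ?u t = (1 - s / D) * (1 - t / D) * (a \<bullet> a) + (s / D) * (t / D) * (b \<bullet> b)"
      unfolding conv using ab
      by (simp add: inner_add inner_commute[of b a] inner_commute algebra_simps)
    also have "\<dots> \<ge> 0"
      using st D by (intro add_nonneg_nonneg mult_nonneg_nonneg) auto
    finally have "wasserstein_dist p (split_measure (?u s)) (split_measure (?u t))
        = mass_factor p weight * norm (?u s - ?u t)"
      using norm[OF st(1)] norm[OF st(2)] a b by (intro wasserstein_dist_split_measure[OF p]) auto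
    also have "?u s - ?u t = ((s - t) / D) *\<^sub>R (b - a)"
      by (simp add: diff_divide_distrib scaleR_left_diff_distrib)
    also have "mass_factor p weight * norm \<dots> = \<bar>(s - t) / D\<bar> * D"
      by (simp only: norm_scaleR norm_minus_commute[of b a] D_def mult.left_commute)
    finally show ?thesis using D by (simp add: abs_mult)
  qed
  then show ?thesis
    unfolding geodesic_def dab using D norm assms(6) by simp
qed

lemma not_CAT_if_orthogonal_splitting:
  fixes a b :: 'a
  assumes p: "1 \<le> p" and ab: "a \<bullet> b = 0" "a \<noteq> 0" "b \<noteq> 0" "norm b = norm a"
    and a: "norm a \<le> \<epsilon> / 3" and X: "\<And>u. norm u \<le> norm a \<Longrightarrow> split_measure u \<in> X"
    and \<kappa>: "ereal (2 * norm a) < model_diameter \<kappa>"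
  shows "\<not> CAT \<kappa> X (wasserstein_dist p)"
proof -
  let ?W = "wasserstein_dist p"
  define D where "D = mass_factor p weight * norm (a - b)"
  have neq: "a \<noteq> b" "- b \<noteq> a"
    using ab by auto
  have D: "0 < D" using weight_pos mass_factor_pos neq by (simp add: D_def)
  \<comment> \<open>The segments from \<open>a\<close> to \<open>b\<close> and from \<open>a\<close>
    to \<open>- b\<close> have equal length, so both geodesics use the same
    \<open>D\<close>.\<close>
  have ab_sum: "norm (a + b) = norm (a - b)"
    using ab by (simp add: norm_eq_sqrt_inner inner_add inner_diff inner_commute)
  have c1: "geodesic X ?W (split_measure a) (split_measure b)
      (\<lambda>s. split_measure (a + (s / D) *\<^sub>R (b - a)))"
    using ab a neq X unfolding D_def by (intro geodesic_split_measure[OF p]) simp_all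
  \<comment> \<open>This side must run from \<open>y\<close> to \<open>x\<close> in the degenerate
    triangle, hence the segment from \<open>- b\<close> to \<open>a\<close>;
    \<open>split_measure (- b)\<close> is then replaced by \<open>split_measure b\<close>.\<close>
  have "geodesic X ?W (split_measure (- b)) (split_measure a)
      (\<lambda>s. split_measure (- b + (s / D) *\<^sub>R (a - (- b))))"
    using geodesic_split_measure[OF p, of "- b" a X] ab a neq X ab_sum
    by (simp add: D_def inner_commute norm_minus_commute add.commute)
  then have c2: "geodesic X ?W (split_measure b) (split_measure a)
      (\<lambda>s. split_measure (- b + (s / D) *\<^sub>R (a - (- b))))"
    by (simp add: split_measure_minus)
  have W: "?W (split_measure a) (split_measure b) = D" "?W (split_measure b) (split_measure a) = D"
    "?W (split_measure b) (split_measure b) = 0"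
    using ab a by (simp_all add: wasserstein_dist_split_measure[OF p] D_def inner_commute norm_minus_commute)
  have mid: "a + ((D / 2) / D) *\<^sub>R (b - a) = (1 / 2) *\<^sub>R (a + b)"
    "- b + ((D - D / 2) / D) *\<^sub>R (a - (- b)) = (1 / 2) *\<^sub>R (a - b)"
    using D by (rule_tac [!] euclidean_eqI) (simp_all add: inner_add_left inner_diff_left field_simps)
  have "b \<bullet> b = a \<bullet> a" using ab(4) by (simp add: norm_eq_sqrt_inner)
  \<comment> \<open>As \<open>a\<close> and \<open>b\<close> have equal norm, \<open>a + b\<close>
    and \<open>a - b\<close> are the orthogonal diagonals of a square. Hence the distance formula
    also applies to the two midpoints, whose difference is \<open>b\<close>.\<close>
  then have orth: "(a + b) \<bullet> (a - b) = 0"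
    using ab(1) by (simp add: inner_add_left inner_diff_right inner_commute[of b a])
  have "?W (split_measure ((1 / 2) *\<^sub>R (a + b))) (split_measure ((1 / 2) *\<^sub>R (a - b)))
      = mass_factor p weight * norm ((1 / 2) *\<^sub>R (a + b) - (1 / 2) *\<^sub>R (a - b))"
    using orth ab(4) a norm_triangle_ineq[of a b] norm_triangle_ineq4[of a b]
    by (intro wasserstein_dist_split_measure[OF p]) simp_all
  also have "(1 / 2) *\<^sub>R (a + b) - (1 / 2) *\<^sub>R (a - b) = b"
    by (rule euclidean_eqI) (simp add: inner_add_left inner_diff_left field_simps)
  finally have far: "0 < ?W (split_measure ((1 / 2) *\<^sub>R (a + b))) (split_measure ((1 / 2) *\<^sub>R (a - b)))"
    using ab weight_pos mass_factor_pos by simp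
  \<comment> \<open>As the weight is at most 1, \<open>D\<close> is bounded by
    \<open>2 * norm a\<close> whatever the mass of the atom.\<close>
  have "D \<le> norm (a - b)"
    unfolding D_def using weight_pos weight_le_1 by (intro mult_left_le_one_le) (simp_all add: mass_factor_le_1 mass_factor_pos less_imp_le)
  also have "\<dots> \<le> 2 * norm a" using norm_triangle_ineq4[of a b] ab by simp
  finally have D\<kappa>: "ereal D < model_diameter \<kappa>"
    using \<kappa> by (meson ereal_less_eq(3) order_le_less_trans)
  show ?thesis
  proof (rule not_CAT_if_branching_geodesics[OF c1 c2, of "D / 2"], unfold W mid)
    show "0 < ?W (split_measure ((1 / 2) *\<^sub>R (a + b))) (split_measure ((1 / 2) *\<^sub>R (a - b)))"
      by (rule far)
  qed (use D D\<kappa> in simp_all)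
qed

end

section \<open>Rounding to a lattice\<close>

definition lattice_round :: "real \<Rightarrow> 'a::euclidean_space \<Rightarrow> 'a"
  where "lattice_round \<epsilon> x = (\<Sum>i\<in>Basis. (\<epsilon> * of_int \<lfloor>(x \<bullet> i) / \<epsilon>\<rfloor>) *\<^sub>R i)"

lemma lattice_round_inner:
  "i \<in> Basis \<Longrightarrow> lattice_round \<epsilon> x \<bullet> i = \<epsilon> * of_int \<lfloor>(x \<bullet> i) / \<epsilon>\<rfloor>"
  by (simp add: lattice_round_def)

lemma lattice_round_measurable [measurable]: "lattice_round \<epsilon> \<in> borel_measurable borel"
  unfolding lattice_round_def by measurable

lemma norm_diff_lattice_round_le:
  fixes x :: "'a::euclidean_space"
  assumes "0 < \<epsilon>"
  shows "norm (x - lattice_round \<epsilon> x) \<le> real DIM('a) * \<epsilon>"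
proof -
  have "norm (x - lattice_round \<epsilon> x) \<le> (\<Sum>i\<in>Basis. \<bar>(x - lattice_round \<epsilon> x) \<bullet> i\<bar>)"
    by (rule norm_le_l1)
  also have "\<dots> \<le> (\<Sum>i\<in>(Basis :: 'a set). \<epsilon>)"
  proof (rule sum_mono)
    fix i :: 'a assume i: "i \<in> Basis"
    have "\<bar>(x \<bullet> i) / \<epsilon> - of_int \<lfloor>(x \<bullet> i) / \<epsilon>\<rfloor>\<bar> \<le> 1" by linarith
    then have "\<epsilon> * \<bar>(x \<bullet> i) / \<epsilon> - of_int \<lfloor>(x \<bullet> i) / \<epsilon>\<rfloor>\<bar> \<le> \<epsilon> * 1"
      using assms by (intro mult_left_mono) simp_all
    also have "\<epsilon> * \<bar>(x \<bullet> i) / \<epsilon> - of_int \<lfloor>(x \<bullet> i) / \<epsilon>\<rfloor>\<bar> = \<bar>\<epsilon> * ((x \<bullet> i) / \<epsilon> - of_int \<lfloor>(x \<bullet> i) / \<epsilon>\<rfloor>)\<bar>"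
      using assms by (simp only: abs_mult abs_of_pos)
    finally show "\<bar>(x - lattice_round \<epsilon> x) \<bullet> i\<bar> \<le> \<epsilon>"
      using assms i by (simp add: inner_diff_left lattice_round_inner right_diff_distrib)
  qed
  finally show ?thesis by simp
qed

text \<open>Coordinates are integer multiples of \<open>\<epsilon>\<close>, so distinct lattice
  points differ by at least \<open>\<epsilon>\<close> in some coordinate.\<close>

lemma lattice_round_separated:
  fixes x y :: "'a::euclidean_space"
  assumes "0 < \<epsilon>" "lattice_round \<epsilon> x \<noteq> lattice_round \<epsilon> y"
  shows "\<epsilon> \<le> dist (lattice_round \<epsilon> x) (lattice_round \<epsilon> y)"
proof -
  let ?x = "\<lambda>i. \<lfloor>(x \<bullet> i) / \<epsilon>\<rfloor>" and ?y = "\<lambda>i. \<lfloor>(y \<bullet> i) / \<epsilon>\<rfloor>"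
  obtain i :: 'a where i: "i \<in> Basis" "lattice_round \<epsilon> x \<bullet> i \<noteq> lattice_round \<epsilon> y \<bullet> i"
    using assms(2) by (subst (asm) euclidean_eq_iff) auto
  then have "1 \<le> \<bar>?x i - ?y i\<bar>" by (auto simp: lattice_round_inner)
  then have "1 \<le> \<bar>real_of_int (?x i) - real_of_int (?y i)\<bar>" by linarith
  then have "\<epsilon> * 1 \<le> \<epsilon> * \<bar>real_of_int (?x i) - real_of_int (?y i)\<bar>"
    using assms by (intro mult_left_mono) simp_all
  also have "\<dots> = \<bar>\<epsilon> * (real_of_int (?x i) - real_of_int (?y i))\<bar>"
    using assms by (simp only: abs_mult abs_of_pos)
  also have "\<dots> = \<bar>(lattice_round \<epsilon> x - lattice_round \<epsilon> y) \<bullet> i\<bar>"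
    using i by (simp add: inner_diff_left lattice_round_inner right_diff_distrib)
  also have "\<dots> \<le> dist (lattice_round \<epsilon> x) (lattice_round \<epsilon> y)"
    unfolding dist_norm using i(1) by (rule Basis_le_norm)
  finally show ?thesis by simp
qed

text \<open>A lattice point depends only on integers indexed by the finite set \<open>Basis\<close>;
  restricting to \<open>Basis\<close> makes the index set a countable product.\<close>

lemma countable_range_lattice_round: "countable (range (lattice_round \<epsilon> :: 'a::euclidean_space \<Rightarrow> 'a))"
proof -
  let ?L = "\<lambda>k :: 'a \<Rightarrow> int. \<Sum>i\<in>Basis. (\<epsilon> * of_int (k i)) *\<^sub>R i"
  have restr: "lattice_round \<epsilon> x = ?L (restrict (\<lambda>i. \<lfloor>(x \<bullet> i) / \<epsilon>\<rfloor>) Basis)" for x :: 'a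
    by (simp add: lattice_round_def)
  have "range (lattice_round \<epsilon>) \<subseteq> ?L ` (PiE Basis (\<lambda>_. UNIV))"
    by (intro image_subsetI) (rule image_eqI, rule restr, rule restrict_PiE_iff[THEN iffD2], simp)
  then show ?thesis
    by (rule countable_subset) (intro countable_image countable_PiE; simp)
qed

text \<open>Countably many fibres of the rounding cover a space of mass 1, so they cannot all be
  null.\<close>

lemma split_atom_lattice_round:
  fixes \<mu> :: "'a::euclidean_space measure"
  assumes "borel_prob \<mu>" "0 < \<epsilon>"
  obtains z where "split_atom \<mu> (lattice_round \<epsilon>) z \<epsilon>"
proof -
  interpret prob_space \<mu> using assms by (simp add: borel_prob_def)
  have sets[simp, measurable_cong]: "sets \<mu> = sets borel" using assms by (simp add: borel_prob_def)
  have space[simp]: "space \<mu> = UNIV" using sets_eq_imp_space_eq[OF sets] by simp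
  let ?R = "range (lattice_round \<epsilon> :: 'a \<Rightarrow> 'a)" and ?A = "\<lambda>z. {x. lattice_round \<epsilon> x = z}"
  have meas: "?A z \<in> sets \<mu>" for z
  proof -
    have "{x \<in> space borel. lattice_round \<epsilon> x = z} \<in> sets borel" by measurable
    then show ?thesis by simp
  qed
  have "\<exists>z\<in>?R. emeasure \<mu> (?A z) \<noteq> 0"
  proof (rule ccontr)
    assume "\<not> (\<exists>z\<in>?R. emeasure \<mu> (?A z) \<noteq> 0)"
    then have "(\<Union>z\<in>?R. ?A z) \<in> null_sets \<mu>"
      using meas by (intro null_sets_UN' countable_range_lattice_round) auto
    moreover have "(\<Union>z\<in>?R. ?A z) = space \<mu>" by auto
    ultimately show False using emeasure_space_1 by (simp add: null_sets_def)
  qed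
  then obtain y where "emeasure \<mu> (?A (lattice_round \<epsilon> y)) \<noteq> 0" by blast
  then have "split_atom \<mu> (lattice_round \<epsilon>) (lattice_round \<epsilon> y) \<epsilon>"
    using assms(2) by unfold_locales
      (simp_all add: lattice_round_separated emeasure_eq_measure zero_less_measure_iff)
  then show thesis by (rule that)
qed

section \<open>Failure of every CAT condition near every measure\<close>

text \<open>\<open>X\<close> is only asked to contain a ball, so that the result applies to balls
  taken inside a neighbourhood.\<close>

theorem not_CAT_wasserstein_ball:
  fixes \<mu> :: "'a::euclidean_space measure"
  assumes dim: "DIM('a) \<ge> 2" and p: "1 \<le> p" and \<mu>: "\<mu> \<in> wasserstein_carrier p" and r: "0 < r"
    and X: "\<And>\<nu>. \<nu> \<in> wasserstein_carrier p \<Longrightarrow> wasserstein_dist p \<mu> \<nu> < r \<Longrightarrow> \<nu> \<in> X"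
  shows "\<not> CAT \<kappa> X (wasserstein_dist p)"
proof -
  \<comment> \<open>With this mesh, rounding moves points by at most \<open>r / 2\<close>, leaving
    room for splitting within radius \<open>r\<close>.\<close>
  define \<epsilon> where "\<epsilon> = r / (2 * real DIM('a))"
  have \<epsilon>: "0 < \<epsilon>" "real DIM('a) * \<epsilon> = r / 2" using r by (simp_all add: \<epsilon>_def)
  have "borel_prob \<mu>" using \<mu> by (auto simp: wasserstein_carrier_def split: if_splits)
  then obtain z where "split_atom \<mu> (lattice_round \<epsilon>) z \<epsilon>"
    using split_atom_lattice_round \<epsilon>(1) by blast
  then interpret split_atom \<mu> "lattice_round \<epsilon>" z \<epsilon> .
  obtain m where m: "0 < m" "ereal m < model_diameter \<kappa>"
  proof (cases "\<kappa> > 0")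
    case True
    then have "0 < pi / sqrt \<kappa>" by simp
    then show thesis
      using that[of "pi / sqrt \<kappa> / 2"] True by (simp add: model_diameter_def field_simps)
  qed (use that[of 1] in \<open>simp add: model_diameter_def\<close>)
  \<comment> \<open>The three bounds serve the distance formula, membership in the ball
    (\<open>r / 2 + r / 3 < r\<close>) and the model diameter.\<close>
  define \<rho> where "\<rho> = Min {\<epsilon> / 3, r / 3, m / 2}"
  have \<rho>: "0 < \<rho>" "\<rho> \<le> \<epsilon> / 3" "\<rho> \<le> r / 3" "\<rho> \<le> m / 2"
    using \<epsilon> r m by (auto simp: \<rho>_def)
  \<comment> \<open>The dimension enters here: two orthogonal directions are needed.\<close>
  obtain i j :: 'a where ij: "i \<in> Basis" "j \<in> Basis" "i \<noteq> j"
    using dim card_le_Suc0_iff_eq[of "Basis :: 'a set"] by (auto simp: not_le[symmetric])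
  show ?thesis
  proof (rule not_CAT_if_orthogonal_splitting[OF p, of "\<rho> *\<^sub>R i" "\<rho> *\<^sub>R j"])
    show "ereal (2 * norm (\<rho> *\<^sub>R i)) < model_diameter \<kappa>"
      using \<rho> m(2) ij by (simp add: order_le_less_trans[of _ "ereal m"])
    fix u :: 'a assume "norm u \<le> norm (\<rho> *\<^sub>R i)"
    then have u: "norm u \<le> r / 3" using \<rho> ij by simp
    show "split_measure u \<in> X"
    proof (rule X)
      have near: "norm (x - lattice_round \<epsilon> x) \<le> r / 2" for x :: 'a
        using norm_diff_lattice_round_le[OF \<epsilon>(1), of x] \<epsilon>(2) by simp
      show "split_measure u \<in> wasserstein_carrier p"
        using dist_split_measure_le(2)[OF p near \<mu>] .
      show "wasserstein_dist p \<mu> (split_measure u) < r"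
        using dist_split_measure_le(1)[OF p near, of u] u r by linarith
    qed
  qed (use \<rho> ij in \<open>simp_all add: inner_Basis nonzero_Basis\<close>)
qed

theorem corollary4p10:
  fixes p :: ennreal
  assumes "CARD('n::finite) \<ge> 2"
    and "1 \<le> p"
  shows "positive_upper_curvature
           (wasserstein_carrier p :: (real ^ 'n) measure set) (wasserstein_dist p)"
proof -
  let ?P = "wasserstein_carrier p :: (real ^ 'n) measure set" and ?W = "wasserstein_dist p"
  \<comment> \<open>No pair of a neighbourhood and a bound qualifies, so the infimum is over the
    empty set.\<close>
  have "\<not> (geodesic_neighborhood ?P ?W \<mu> U \<and> curvature_le \<kappa> U ?W)" if \<mu>: "\<mu> \<in> ?P" for \<mu> U \<kappa>
  proof
    assume U: "geodesic_neighborhood ?P ?W \<mu> U \<and> curvature_le \<kappa> U ?W"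
    then obtain r\<^sub>0 where r0: "0 < r\<^sub>0" "\<And>\<nu>. \<nu> \<in> ?P \<Longrightarrow> ?W \<mu> \<nu> < r\<^sub>0 \<Longrightarrow> \<nu> \<in> U"
      by (auto simp: geodesic_neighborhood_def)
    have "borel_prob \<mu>" using \<mu> by (auto simp: wasserstein_carrier_def split: if_splits)
    \<comment> \<open>The identity coupling gives distance 0 from \<open>\<mu>\<close> to itself,
      which puts \<open>\<mu>\<close> into \<open>U\<close>.\<close>
    then have "?W (distr \<mu> borel (\<lambda>x. x)) (distr \<mu> borel (\<lambda>x. x)) \<le> 0"
      using assms(2) by (intro wasserstein_dist_coupling_le) (auto simp: borel_prob_def cong: measurable_cong_sets)
    moreover have "distr \<mu> borel (\<lambda>x. x) = \<mu>"
      using \<open>borel_prob \<mu>\<close> by (intro distr_id2) (simp add: borel_prob_def)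
    ultimately have "\<mu> \<in> U" using \<mu> r0 by simp
    with U obtain r where r: "0 < r" "CAT \<kappa> {\<nu>\<in>U. ?W \<mu> \<nu> < r} ?W"
      by (auto simp: curvature_le_def)
    \<comment> \<open>Inside radius \<open>min r r\<^sub>0\<close> every measure of the carrier lies
      in \<open>U\<close> and in the ball of radius \<open>r\<close>.\<close>
    moreover have "\<not> CAT \<kappa> {\<nu>\<in>U. ?W \<mu> \<nu> < r} ?W"
      using assms \<mu> r0 r(1) by (intro not_CAT_wasserstein_ball[of p \<mu> "min r r\<^sub>0"]) auto
    ultimately show False by blast
  qed
  then have "upper_curvature ?P ?W \<mu> = Inf {}" if "\<mu> \<in> ?P" for \<mu>
    unfolding upper_curvature_def using that by (intro arg_cong[of _ _ Inf]) blast
  then show ?thesis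
    by (simp add: positive_upper_curvature_def top_ereal_def)
qed

end
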